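(* Let $n\ge 1$ be an integer, let $\alpha,b>0$, $\delta\in(0,1)$, $0<a_0\le a_1$ be real numbers, and let $\tau_0,\tau_1,\tau_2\ge 0$ be integers with $\tau_0+\tau_1=\tau_2$. Consider the delayed discrete-time system $$\begin{cases} q_0(t+1)=q_0(t)+\alpha q_0(t)\Big[a_0-bq_0(t)-b\delta\sum_{i=1}^n q_i(t-\tau_1)\Big],\\[2pt] q_j(t+1)=\dfrac{a_1}{2b}-\dfrac{\delta}{2}q_0(t-\tau_0)-\dfrac{\delta}{2}\sum_{i=1,\,i\ne j}^n q_i(t-\tau_2),\quad j=1,\dots,n.\end{cases}$$ Assume that $$[2+(n-1)\delta]\,a_0>n\delta a_1\qquad\text{and}\qquad a_1>\delta a_0,$$ and let $E_+=(q_0^\star,q_1^\star,\dots,q_1^\star)\in\mathbb{R}^{n+1}$ be the positive equilibrium, where $$q_0^\star=\frac{[2+(n-1)\delta]a_0-n\delta a_1}{b[2+(n-1)\delta-n\delta^2]},\qquad q_1^\star=\frac{a_1-\delta a_0}{b[2+(n-1)\delta-n\delta^2]}.$$ Set $$\varepsilon_0=\frac{n\delta^2}{2},\qquad \varepsilon_1=\alpha\,\frac{[2+(n-1)\delta]a_0-n\delta a_1}{2+(n-1)\delta-n\delta^2}-1,\qquad \varepsilon_2=\frac{(n-1)\delta}{2}.$$ If $$\varepsilon_2<1\qquad\text{and}\qquad \varepsilon_1<\frac{1-\varepsilon_2-\varepsilon_0}{1-\varepsilon_2+\varepsilon_0},$$ then the equilibrium point $E_+$ is asymptotically stable.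
   Context: Let $\tau=\max\{\tau_0,\tau_1,\tau_2\}$. The delayed system is identified with the (delay-free) map $F$ on $\mathbb{R}^{(n+1)(\tau+1)}$ that sends the history $(q(t),q(t-1),\dots,q(t-\tau))$, with $q=(q_0,\dots,q_n)$, to $(q(t+1),q(t),\dots,q(t-\tau+1))$. An equilibrium $E\in\mathbb{R}^{n+1}$ corresponds to the fixed point $(E,\dots,E)$ of $F$. "Asymptotically stable" means locally asymptotically stable: the fixed point $(E,\dots,E)$ is Lyapunov stable under iteration of $F$, and all orbits starting sufficiently close to it converge to it. *)

theory Defs
  imports "HOL-Analysis.Analysis"
begin

(* A history (q(t), q(t-1), ..., q(t-tau)) with q = (q_0, ..., q_n) is a function x on
   lag/component pairs: x (k, i) = q_i(t-k).  The PiE carrier makes such functions equal as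
   soon as they agree on the index set, so this is R^((n+1)(tau+1)); the metric is Euclidean. *)

definition history_index :: "nat \<Rightarrow> nat \<Rightarrow> (nat \<times> nat) set" where
  "history_index n \<tau> = {0..\<tau>} \<times> {0..n}"

definition history_space :: "nat \<Rightarrow> nat \<Rightarrow> (nat \<times> nat \<Rightarrow> real) set" where
  "history_space n \<tau> = (history_index n \<tau> \<rightarrow>\<^sub>E UNIV)"

definition history_dist ::
    "nat \<Rightarrow> nat \<Rightarrow> (nat \<times> nat \<Rightarrow> real) \<Rightarrow> (nat \<times> nat \<Rightarrow> real) \<Rightarrow> real" where
  "history_dist n \<tau> x y = L2_set (\<lambda>p. x p - y p) (history_index n \<tau>)"

definition constant_history :: "nat \<Rightarrow> nat \<Rightarrow> (nat \<Rightarrow> real) \<Rightarrow> nat \<times> nat \<Rightarrow> real" where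
  "constant_history n \<tau> E = (\<lambda>(k, i)\<in>history_index n \<tau>. E i)"

(* q_i(t+1), as a function of the history x at time t. *)
definition next_quantity ::
    "nat \<Rightarrow> real \<Rightarrow> real \<Rightarrow> real \<Rightarrow> real \<Rightarrow> real \<Rightarrow> nat \<Rightarrow> nat \<Rightarrow> nat
      \<Rightarrow> (nat \<times> nat \<Rightarrow> real) \<Rightarrow> nat \<Rightarrow> real" where
  "next_quantity n \<alpha> b \<delta> a\<^sub>0 a\<^sub>1 \<tau>\<^sub>0 \<tau>\<^sub>1 \<tau>\<^sub>2 x i =
     (if i = 0
      then x (0, 0) + \<alpha> * x (0, 0) * (a\<^sub>0 - b * x (0, 0) - b * \<delta> * (\<Sum>j=1..n. x (\<tau>\<^sub>1, j)))
      else a\<^sub>1 / (2 * b) - \<delta> / 2 * x (\<tau>\<^sub>0, 0) - \<delta> / 2 * (\<Sum>j\<in>{1..n} - {i}. x (\<tau>\<^sub>2, j)))"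

definition max_delay :: "nat \<Rightarrow> nat \<Rightarrow> nat \<Rightarrow> nat" where
  "max_delay \<tau>\<^sub>0 \<tau>\<^sub>1 \<tau>\<^sub>2 = Max {\<tau>\<^sub>0, \<tau>\<^sub>1, \<tau>\<^sub>2}"

definition history_map ::
    "nat \<Rightarrow> real \<Rightarrow> real \<Rightarrow> real \<Rightarrow> real \<Rightarrow> real \<Rightarrow> nat \<Rightarrow> nat \<Rightarrow> nat
      \<Rightarrow> (nat \<times> nat \<Rightarrow> real) \<Rightarrow> nat \<times> nat \<Rightarrow> real" where
  "history_map n \<alpha> b \<delta> a\<^sub>0 a\<^sub>1 \<tau>\<^sub>0 \<tau>\<^sub>1 \<tau>\<^sub>2 x =
     (\<lambda>(k, i)\<in>history_index n (max_delay \<tau>\<^sub>0 \<tau>\<^sub>1 \<tau>\<^sub>2).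
        if k = 0 then next_quantity n \<alpha> b \<delta> a\<^sub>0 a\<^sub>1 \<tau>\<^sub>0 \<tau>\<^sub>1 \<tau>\<^sub>2 x i else x (k - 1, i))"

definition lyapunov_stable :: "'a set \<Rightarrow> ('a \<Rightarrow> 'a \<Rightarrow> real) \<Rightarrow> ('a \<Rightarrow> 'a) \<Rightarrow> 'a \<Rightarrow> bool" where
  "lyapunov_stable M d F p \<longleftrightarrow>
     (\<forall>\<epsilon>>0. \<exists>r>0. \<forall>x\<in>M. d x p < r \<longrightarrow> (\<forall>t. d ((F ^^ t) x) p < \<epsilon>))"

definition locally_attractive :: "'a set \<Rightarrow> ('a \<Rightarrow> 'a \<Rightarrow> real) \<Rightarrow> ('a \<Rightarrow> 'a) \<Rightarrow> 'a \<Rightarrow> bool" where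
  "locally_attractive M d F p \<longleftrightarrow>
     (\<exists>r>0. \<forall>x\<in>M. d x p < r \<longrightarrow> (\<lambda>t. d ((F ^^ t) x) p) \<longlonglongrightarrow> 0)"

definition asymptotically_stable_fixpoint ::
    "'a set \<Rightarrow> ('a \<Rightarrow> 'a \<Rightarrow> real) \<Rightarrow> ('a \<Rightarrow> 'a) \<Rightarrow> 'a \<Rightarrow> bool" where
  "asymptotically_stable_fixpoint M d F p \<longleftrightarrow>
     p \<in> M \<and> F p = p \<and> lyapunov_stable M d F p \<and> locally_attractive M d F p"

definition asymptotically_stable_equilibrium ::
    "nat \<Rightarrow> real \<Rightarrow> real \<Rightarrow> real \<Rightarrow> real \<Rightarrow> real \<Rightarrow> nat \<Rightarrow> nat \<Rightarrow> nat
      \<Rightarrow> (nat \<Rightarrow> real) \<Rightarrow> bool" where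
  "asymptotically_stable_equilibrium n \<alpha> b \<delta> a\<^sub>0 a\<^sub>1 \<tau>\<^sub>0 \<tau>\<^sub>1 \<tau>\<^sub>2 E \<longleftrightarrow>
     (let \<tau> = max_delay \<tau>\<^sub>0 \<tau>\<^sub>1 \<tau>\<^sub>2 in
      asymptotically_stable_fixpoint (history_space n \<tau>) (history_dist n \<tau>)
        (history_map n \<alpha> b \<delta> a\<^sub>0 a\<^sub>1 \<tau>\<^sub>0 \<tau>\<^sub>1 \<tau>\<^sub>2) (constant_history n \<tau> E))"

lemma Metric_space_history: "Metric_space (history_space n \<tau>) (history_dist n \<tau>)"
proof
  fix x y z
  show "0 \<le> history_dist n \<tau> x y"
    by (simp add: history_dist_def)
  show "history_dist n \<tau> x y = history_dist n \<tau> y x"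
    by (simp add: history_dist_def L2_set_def power2_commute)
  have fin: "finite (history_index n \<tau>)"
    by (simp add: history_index_def)
  show "history_dist n \<tau> x y = 0 \<longleftrightarrow> x = y" if "x \<in> history_space n \<tau>" "y \<in> history_space n \<tau>"
    using that fin PiE_ext[of x _ "\<lambda>_. UNIV" y]
    by (auto simp: history_dist_def history_space_def L2_set_eq_0_iff)
  show "history_dist n \<tau> x z \<le> history_dist n \<tau> x y + history_dist n \<tau> y z"
    using L2_set_triangle_ineq[of "\<lambda>p. x p - y p" "\<lambda>p. y p - z p" "history_index n \<tau>"]
    by (simp add: history_dist_def)
qed

lemma history_map_in_space:
  "history_map n \<alpha> b \<delta> a\<^sub>0 a\<^sub>1 \<tau>\<^sub>0 \<tau>\<^sub>1 \<tau>\<^sub>2 x \<in> history_space n (max_delay \<tau>\<^sub>0 \<tau>\<^sub>1 \<tau>\<^sub>2)"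
  by (simp add: history_map_def history_space_def)

end

theory Submission
  imports Defs
begin

text \<open>
  In deviations \<open>u\<close> from the equilibrium the system is a feedback loop between the leader \<open>u\<^sub>0\<close> and
  the total \<open>S\<close> of the followers. The leader's step is exactly
  \<open>u\<^sub>0(t+1) = - a' u\<^sub>0(t) - (1 + a') \<delta> S(t - \<tau>\<^sub>1)\<close> with \<open>a' = \<alpha> b q\<^sub>0(t) - 1\<close> close to \<open>\<epsilon>\<^sub>1\<close>, and
  \<open>S(t+1) = - y(t - \<tau>\<^sub>0)\<close> with \<open>y(t) = (n \<delta> / 2) u\<^sub>0(t) + \<epsilon>\<^sub>2 S(t - \<tau>\<^sub>1)\<close>, because
  \<open>\<tau>\<^sub>2 = \<tau>\<^sub>0 + \<tau>\<^sub>1\<close>. After scaling \<open>u\<^sub>0\<close> by the square root of \<open>p = n / (2 (1 + \<epsilon>\<^sub>1))\<close>, the map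
  \<open>(u\<^sub>0(t), S(t - \<tau>\<^sub>1)) \<mapsto> (u\<^sub>0(t+1), y(t))\<close> becomes at \<open>a' = \<epsilon>\<^sub>1\<close>, up to signs, the symmetric matrix
  with diagonal \<open>\<epsilon>\<^sub>1, \<epsilon>\<^sub>2\<close> and squared off-diagonal entry \<open>(1 + \<epsilon>\<^sub>1) \<epsilon>\<^sub>0\<close>. The hypothesis on \<open>\<epsilon>\<^sub>1\<close>
  says that its eigenvalues are below \<open>1\<close>, and they are above \<open>-1\<close> because \<open>\<epsilon>\<^sub>0 < 1 + \<epsilon>\<^sub>2\<close>. So the
  map is a contraction, also for \<open>a'\<close> near \<open>\<epsilon>\<^sub>1\<close>, and pure delays preserve energy: the energy stored in
  the loop is a Lyapunov function that decreases by a multiple of the squares of its inputs. These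
  drive the single followers, whose own dynamics contract by \<open>\<delta> / 2\<close>. Adding a norm with weights
  decreasing in the lag gives a quadratic Lyapunov functional on histories.
\<close>

section \<open>Lyapunov's direct method with quadratic bounds\<close>

text \<open>The upper bound turns the additive decrease into a geometric one inside the ball of
  radius \<open>r\<close>. The sublevel set \<open>V x < c * r\<^sup>2\<close> lies in that ball by
  the lower bound and is mapped into itself, so the decrease stays available along the whole
  orbit.\<close>

lemma quadratic_lyapunov_asymptotically_stable:
  fixes d :: "'a \<Rightarrow> 'a \<Rightarrow> real" and V :: "'a \<Rightarrow> real"
  assumes p: "p \<in> M" "F p = p" and F: "F \<in> M \<rightarrow> M"
    and d: "\<And>x. x \<in> M \<Longrightarrow> 0 \<le> d x p"
    and pos: "0 < c" "0 < C" "0 < \<eta>" "0 < r"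
    and lower: "\<And>x. x \<in> M \<Longrightarrow> c * (d x p)\<^sup>2 \<le> V x"
    and upper: "\<And>x. x \<in> M \<Longrightarrow> V x \<le> C * (d x p)\<^sup>2"
    and decrease: "\<And>x. x \<in> M \<Longrightarrow> d x p < r \<Longrightarrow> V (F x) \<le> V x - \<eta> * (d x p)\<^sup>2"
  shows "asymptotically_stable_fixpoint M d F p"
proof -
  \<comment> \<open>The maximum with \<open>0\<close> keeps the powers of \<open>\<mu>\<close>
    nonnegative without a comparison of \<open>\<eta>\<close> and \<open>C\<close>.\<close>
  define \<mu> where "\<mu> = max 0 (1 - \<eta> / C)"
  have \<mu>: "0 \<le> \<mu>" "\<mu> < 1"
    using pos by (auto simp: \<mu>_def)
  have V_nonneg: "0 \<le> V x" if "x \<in> M" for x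
    using order_trans[OF _ lower[OF that], of 0] pos by simp
  have contract: "V (F x) \<le> \<mu> * V x" if "x \<in> M" "d x p < r" for x
  proof -
    have "\<eta> / C * V x \<le> \<eta> / C * (C * (d x p)\<^sup>2)"
      using upper[OF that(1)] pos by (intro mult_left_mono) auto
    then have "\<eta> / C * V x \<le> \<eta> * (d x p)\<^sup>2"
      using pos by simp
    then have "V (F x) \<le> (1 - \<eta> / C) * V x"
      using decrease[OF that] by (simp add: left_diff_distrib)
    also have "\<dots> \<le> \<mu> * V x"
      using V_nonneg[OF that(1)] by (intro mult_right_mono) (auto simp: \<mu>_def)
    finally show ?thesis .
  qed
  have close: "d x p < s" if "x \<in> M" "V x < c * s\<^sup>2" "0 < s" for x s
  proof (rule power2_less_imp_less)
    have "c * (d x p)\<^sup>2 < c * s\<^sup>2"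
      using lower[OF that(1)] that(2) by linarith
    then show "(d x p)\<^sup>2 < s\<^sup>2"
      using pos by simp
    show "0 \<le> s"
      using that(3) by simp
  qed
  have orbit: "(F ^^ t) x \<in> M \<and> V ((F ^^ t) x) \<le> \<mu> ^ t * V x"
    if "x \<in> M" "V x < c * r\<^sup>2" for x t
  proof (induction t)
    case 0
    then show ?case using that by simp
  next
    case (Suc t)
    let ?y = "(F ^^ t) x"
    have "\<mu> ^ t * V x \<le> 1 * V x"
      using \<mu> V_nonneg[OF that(1)] by (intro mult_right_mono) (auto simp: power_le_one)
    then have "d ?y p < r"
      using Suc that pos by (intro close) auto
    then have "V (F ?y) \<le> \<mu> * V ?y"
      using contract Suc by blast
    also have "\<dots> \<le> \<mu> * (\<mu> ^ t * V x)"
      using Suc \<mu> by (intro mult_left_mono) auto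
    finally show ?case
      using Suc F by (auto simp: mult.assoc)
  qed
  \<comment> \<open>The radius is read off from
    \<open>V x \<le> C * (d x p)\<^sup>2 < c * s\<^sup>2\<close>.\<close>
  have basin: "V x < c * s\<^sup>2" if "x \<in> M" "d x p < sqrt (c / C) * s" "0 < s" for x s
  proof -
    have "(d x p)\<^sup>2 < (sqrt (c / C) * s)\<^sup>2"
      using that d by (intro power_strict_mono) auto
    also have "\<dots> = c / C * s\<^sup>2"
      using pos by (simp add: power_mult_distrib)
    finally have "C * (d x p)\<^sup>2 < c * s\<^sup>2"
      using pos by (simp add: field_simps)
    then show ?thesis
      using upper[OF that(1)] by linarith
  qed
  have "lyapunov_stable M d F p"
    unfolding lyapunov_stable_def
  proof (intro allI impI)
    fix \<epsilon> :: real assume "0 < \<epsilon>"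
    \<comment> \<open>At most \<open>\<epsilon>\<close> for the stability claim, at most
      \<open>r\<close> for \<open>orbit\<close> to apply.\<close>
    define s where "s = min \<epsilon> r"
    have s: "0 < s" "s \<le> \<epsilon>" "s \<le> r"
      using \<open>0 < \<epsilon>\<close> pos by (auto simp: s_def)
    have "d ((F ^^ t) x) p < \<epsilon>" if x: "x \<in> M" "d x p < sqrt (c / C) * s" for x t
    proof -
      have Vx: "V x < c * s\<^sup>2"
        using basin x s by blast
      have "s\<^sup>2 \<le> r\<^sup>2"
        using s by (intro power_mono) auto
      then have "c * s\<^sup>2 \<le> c * r\<^sup>2"
        using pos by simp
      with Vx have "V x < c * r\<^sup>2" by linarith
      note o = orbit[OF x(1) this, of t]
      have "\<mu> ^ t * V x \<le> 1 * V x"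
        using \<mu> V_nonneg[OF x(1)] by (intro mult_right_mono) (auto simp: power_le_one)
      then have "d ((F ^^ t) x) p < s"
        using o Vx s by (intro close) auto
      then show ?thesis using s by simp
    qed
    then show "\<exists>r>0. \<forall>x\<in>M. d x p < r \<longrightarrow> (\<forall>t. d ((F ^^ t) x) p < \<epsilon>)"
      using s pos by (intro exI[of _ "sqrt (c / C) * s"]) auto
  qed
  moreover have "locally_attractive M d F p"
    unfolding locally_attractive_def
  proof (intro exI[of _ "sqrt (c / C) * r"] conjI ballI impI)
    show "0 < sqrt (c / C) * r"
      using pos by simp
    fix x assume x: "x \<in> M" "d x p < sqrt (c / C) * r"
    note o = orbit[OF x(1) basin[OF x \<open>0 < r\<close>]]
    have bound: "d ((F ^^ t) x) p \<le> sqrt (\<mu> ^ t * V x / c)" for t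
    proof (rule real_le_rsqrt)
      have "c * (d ((F ^^ t) x) p)\<^sup>2 \<le> \<mu> ^ t * V x"
        using lower[of "(F ^^ t) x"] o[of t] by linarith
      then show "(d ((F ^^ t) x) p)\<^sup>2 \<le> \<mu> ^ t * V x / c"
        using pos by (simp add: field_simps)
    qed
    have "(\<lambda>t. sqrt (\<mu> ^ t * V x / c)) \<longlonglongrightarrow> sqrt (0 * V x / c)"
      using \<mu> pos by (intro tendsto_intros LIMSEQ_power_zero) auto
    then have limit: "(\<lambda>t. sqrt (\<mu> ^ t * V x / c)) \<longlonglongrightarrow> 0"
      by simp
    show "(\<lambda>t. d ((F ^^ t) x) p) \<longlonglongrightarrow> 0"
    proof (rule tendsto_sandwich[OF _ _ tendsto_const limit]; intro always_eventually allI)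
      show "0 \<le> d ((F ^^ t) x) p" for t
        using d o by blast
    qed (rule bound)
  qed
  ultimately show ?thesis
    using p by (simp add: asymptotically_stable_fixpoint_def)
qed

section \<open>A two-dimensional contraction and its perturbations\<close>

lemma binary_quadratic_form_nonneg:
  fixes A B C x y :: real
  assumes "0 < A" "B\<^sup>2 \<le> A * C"
  shows "0 \<le> A * x\<^sup>2 - 2 * B * x * y + C * y\<^sup>2"
proof -
  have "0 \<le> (A * x - B * y)\<^sup>2 + (A * C - B\<^sup>2) * y\<^sup>2"
    using assms by simp
  also have "\<dots> = A * (A * x\<^sup>2 - 2 * B * x * y + C * y\<^sup>2)"
    by (simp add: power2_eq_square algebra_simps)
  finally show ?thesis
    using assms by (simp add: zero_le_mult_iff)
qed

text \<open>The gap between the two sides is a quadratic form in \<open>u\<close> and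
  \<open>s\<close>. Its leading coefficient and its determinant are strictly positive for margin
  \<open>0\<close> and \<open>a' = a\<close>, hence by continuity also for a small margin and nearby
  \<open>a'\<close>.\<close>

lemma robust_contraction:
  fixes a e \<delta> m p \<beta> :: real
  assumes a: "\<bar>a\<bar> < 1" and p: "0 < p"
    and \<beta>: "\<beta> = p * (1 + a) * \<delta>" and m: "m = p * (1 + a)\<^sup>2 * \<delta>\<^sup>2"
    and gain: "m < (1 - a) * (1 - e)" "m < (1 + a) * (1 + e)"
  obtains \<kappa> r where "0 < \<kappa>" "0 < r"
    "\<And>a' u s. \<bar>a' - a\<bar> < r \<Longrightarrow>
      p * (a' * u + (1 + a') * \<delta> * s)\<^sup>2 + (\<beta> * u + e * s)\<^sup>2 \<le> (1 - 2 * \<kappa>) * (p * u\<^sup>2 + s\<^sup>2)"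
proof -
  \<comment> \<open>\<open>A z * u\<^sup>2 - 2 * B z * u * s + C z * s\<^sup>2\<close> is the right
    side minus the left side, with \<open>z\<close> standing for the pair
    \<open>(\<kappa>, a')\<close>.\<close>
  define A where "A z = (1 - 2 * fst z) * p - p * (snd z)\<^sup>2 - \<beta>\<^sup>2" for z :: "real \<times> real"
  define B where "B z = p * snd z * (1 + snd z) * \<delta> + \<beta> * e" for z :: "real \<times> real"
  define C where "C z = (1 - 2 * fst z) - p * (1 + snd z)\<^sup>2 * \<delta>\<^sup>2 - e\<^sup>2" for z :: "real \<times> real"
  have cont: "continuous_on UNIV A" "continuous_on UNIV (\<lambda>z. A z * C z - (B z)\<^sup>2)"
    unfolding A_def B_def C_def by (intro continuous_intros)+
  have \<beta>_sq: "\<beta>\<^sup>2 = p * m"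
    unfolding \<beta> m by (simp add: power2_eq_square algebra_simps)
  \<comment> \<open>a convex combination of the two gain conditions eliminates \<open>e\<close>\<close>
  have "(1 + a) * m + (1 - a) * m < (1 + a) * ((1 - a) * (1 - e)) + (1 - a) * ((1 + a) * (1 + e))"
    using a gain by (intro add_strict_mono mult_strict_left_mono) auto
  then have "m < 1 - a\<^sup>2"
    by (simp add: algebra_simps power2_eq_square)
  then have "0 < p * (1 - a\<^sup>2 - m)"
    using p by simp
  then have A_pos: "0 < A (0, a)"
    by (simp add: A_def \<beta>_sq algebra_simps)
  have B0: "B (0, a) = \<beta> * (a + e)"
    by (simp add: B_def \<beta> algebra_simps)
  have A0: "A (0, a) = p * (1 - a\<^sup>2 - m)"
    by (simp add: A_def \<beta>_sq algebra_simps)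
  have C0: "C (0, a) = 1 - m - e\<^sup>2"
    by (simp add: C_def m algebra_simps)
  \<comment> \<open>For the symmetric matrix M with diagonal \<open>a\<close>, \<open>e\<close> and
    off-diagonal entry \<open>sqrt m\<close>, this is \<open>p\<close> times det(I - M^2) = det(I -
    M) det(I + M). The two gain conditions make both factors positive.\<close>
  have "A (0, a) * C (0, a) - (B (0, a))\<^sup>2
      = p * (((1 - a) * (1 - e) - m) * ((1 + a) * (1 + e) - m))"
    unfolding A0 B0 C0 power_mult_distrib \<beta>_sq by (simp add: power2_eq_square algebra_simps)
  also have "0 < \<dots>"
    using p gain by simp
  finally have det_pos: "0 < A (0, a) * C (0, a) - (B (0, a))\<^sup>2" .
  have "eventually (\<lambda>z. 0 < A z) (nhds (0, a))"
    using cont(1) A_pos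
    by (intro order_tendstoD(1)[of _ "A (0, a)"])
      (auto simp: continuous_on_eq_continuous_at isCont_def tendsto_at_iff_tendsto_nhds)
  moreover have "eventually (\<lambda>z. 0 < A z * C z - (B z)\<^sup>2) (nhds (0, a))"
    using cont(2) det_pos
    by (intro order_tendstoD(1)[of _ "A (0, a) * C (0, a) - (B (0, a))\<^sup>2"])
      (simp_all add: continuous_on_eq_continuous_at isCont_def
        tendsto_at_iff_tendsto_nhds[where g = "\<lambda>z. A z * C z - (B z)\<^sup>2"])
  ultimately have "eventually (\<lambda>z. 0 < A z \<and> 0 < A z * C z - (B z)\<^sup>2) (nhds (0, a))"
    by (rule eventually_conj)
  then obtain \<rho> where \<rho>: "0 < \<rho>"
    "\<And>z. dist z (0, a) < \<rho> \<Longrightarrow> 0 < A z \<and> 0 < A z * C z - (B z)\<^sup>2"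
    unfolding eventually_nhds_metric by blast
  show thesis
  \<comment> \<open>The margin and the perturbation of \<open>a\<close> each take half of the radius
    \<open>\<rho>\<close>.\<close>
  proof (rule that[of "\<rho> / 2" "\<rho> / 2"])
    fix a' u s :: real
    assume a': "\<bar>a' - a\<bar> < \<rho> / 2"
    define z where "z = (\<rho> / 2, a')"
    have "dist z (0, a) \<le> \<bar>\<rho> / 2\<bar> + \<bar>a' - a\<bar>"
      using sqrt_sum_squares_le_sum_abs[of "\<rho> / 2" "a' - a"]
      by (simp only: z_def dist_Pair_Pair dist_real_def diff_0_right power2_abs fst_conv snd_conv)
    also have "\<dots> < \<rho>"
      using a' \<rho>(1) by simp
    finally have "0 < A z" "(B z)\<^sup>2 \<le> A z * C z"
      using \<rho>(2)[of z] by auto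
    from binary_quadratic_form_nonneg[OF this, of u s]
    show "p * (a' * u + (1 + a') * \<delta> * s)\<^sup>2 + (\<beta> * u + e * s)\<^sup>2
        \<le> (1 - 2 * (\<rho> / 2)) * (p * u\<^sup>2 + s\<^sup>2)"
      by (simp add: A_def B_def C_def z_def power2_eq_square algebra_simps)
  qed (use \<rho> in auto)
qed

section \<open>The Lyapunov functional on histories\<close>

text \<open>Throughout, \<open>u k i\<close> is the deviation of component \<open>i\<close> at lag
  \<open>k\<close>. Nothing nonlinear appears here: the leader enters only through an energy
  inequality in \<open>functional_decrease\<close>.\<close>

locale oligopoly_functional =
  fixes n T\<^sub>0 T\<^sub>1 :: nat and \<delta> \<beta> e p \<kappa> :: real
  assumes p: "0 < p" and \<kappa>: "0 < \<kappa>" and \<delta>: "0 \<le> \<delta>" "\<delta> \<le> 1"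
    and \<beta>: "\<beta> = real n * \<delta> / 2" and e: "e = (real n - 1) * \<delta> / 2"
begin

definition total :: "(nat \<Rightarrow> nat \<Rightarrow> real) \<Rightarrow> nat \<Rightarrow> real" where
  "total u k = (\<Sum>j=1..n. u k j)"

definition sqnorm :: "(nat \<Rightarrow> nat \<Rightarrow> real) \<Rightarrow> nat \<Rightarrow> real" where
  "sqnorm u k = (\<Sum>i\<le>n. (u k i)\<^sup>2)"

definition response :: "(nat \<Rightarrow> nat \<Rightarrow> real) \<Rightarrow> nat \<Rightarrow> real" where
  "response u k = \<beta> * u k 0 + e * total u (k + T\<^sub>1)"

definition supply_rate :: "(nat \<Rightarrow> nat \<Rightarrow> real) \<Rightarrow> nat \<Rightarrow> real" where
  "supply_rate u k = p * (u k 0)\<^sup>2 + (total u (k + T\<^sub>1))\<^sup>2"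

text \<open>The sums are the contents of two delay lines, of lengths \<open>T\<^sub>1\<close> and
  \<open>T\<^sub>0\<close>. The \<open>\<kappa>\<close> term carries a copy of the supply along the
  second line, so that dissipation is also available at lag \<open>T\<^sub>0\<close>, where the
  followers read their inputs.\<close>

definition storage :: "(nat \<Rightarrow> nat \<Rightarrow> real) \<Rightarrow> real" where
  "storage u = p * (u 0 0)\<^sup>2 + (\<Sum>k\<le>T\<^sub>1. (total u k)\<^sup>2)
     + (\<Sum>k<T\<^sub>0. (response u (Suc k))\<^sup>2 + \<kappa> * supply_rate u (Suc k))"

text \<open>With this rate the weights of \<open>fading_norm\<close> are at least \<open>1 / 2\<close>, even one lag beyond the last.\<close>

definition rate :: real where
  "rate = 1 / (2 * (real (T\<^sub>0 + T\<^sub>1) + 1))"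

text \<open>\<open>storage\<close> sees the followers only through their totals; this sum sees every
  entry. Since the weights fall linearly, ageing by one lag costs each entry the same multiple
  \<open>rate\<close> of its square.\<close>

definition fading_norm :: "(nat \<Rightarrow> nat \<Rightarrow> real) \<Rightarrow> real" where
  "fading_norm u = (\<Sum>k\<le>T\<^sub>0 + T\<^sub>1. (1 - real k * rate) * sqnorm u k)"

text \<open>Large enough for the weighted storage loss at lags \<open>0\<close> and
  \<open>T\<^sub>0\<close> to absorb the supply terms that bound the new entries: factor
  \<open>1 / p\<close> for the leader and \<open>1 / p + 1\<close> for each of the \<open>n\<close>
  followers.\<close>

definition weight :: real where
  "weight = (real n + 1) * (1 / p + 1) / \<kappa>"

definition functional :: "(nat \<Rightarrow> nat \<Rightarrow> real) \<Rightarrow> real" where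
  "functional u = weight * storage u + fading_norm u"

definition hist_sqnorm :: "(nat \<Rightarrow> nat \<Rightarrow> real) \<Rightarrow> real" where
  "hist_sqnorm u = (\<Sum>k\<le>T\<^sub>0 + T\<^sub>1. sqnorm u k)"

lemma sqnorm_nonneg: "0 \<le> sqnorm u k"
  unfolding sqnorm_def by (intro sum_nonneg) auto

lemma supply_nonneg: "0 \<le> supply_rate u k"
  using p by (simp add: supply_rate_def)

lemma weight_pos: "0 < weight"
  unfolding weight_def using p \<kappa> by (intro divide_pos_pos mult_pos_pos add_nonneg_pos add_pos_pos) auto

lemma storage_nonneg: "0 \<le> storage u"
  unfolding storage_def using p \<kappa> supply_nonneg
  by (intro add_nonneg_nonneg sum_nonneg) auto

lemma rate_pos: "0 < rate"
  by (simp add: rate_def)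

lemma rate_total: "(real (T\<^sub>0 + T\<^sub>1) + 1) * rate = 1 / 2"
  by (simp add: rate_def field_simps)

lemma functional_lower: "1 / 2 * hist_sqnorm u \<le> functional u"
proof -
  have "1 / 2 * hist_sqnorm u \<le> fading_norm u"
    unfolding hist_sqnorm_def fading_norm_def sum_distrib_left
  proof (intro sum_mono mult_right_mono sqnorm_nonneg)
    fix k assume "k \<in> {..T\<^sub>0 + T\<^sub>1}"
    then have "real k * rate \<le> (real (T\<^sub>0 + T\<^sub>1) + 1) * rate"
      using rate_pos by (intro mult_right_mono) auto
    then show "1 / 2 \<le> 1 - real k * rate"
      unfolding rate_total by simp
  qed
  moreover have "0 \<le> weight * storage u"
    using weight_pos storage_nonneg by simp
  ultimately show ?thesis
    by (simp add: functional_def)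
qed

lemma sqnorm_le_hist_sqnorm: "k \<le> T\<^sub>0 + T\<^sub>1 \<Longrightarrow> sqnorm u k \<le> hist_sqnorm u"
  unfolding hist_sqnorm_def using sqnorm_nonneg by (intro member_le_sum) auto

lemma square_le_sqnorm: "i \<le> n \<Longrightarrow> (u k i)\<^sup>2 \<le> sqnorm u k"
  unfolding sqnorm_def by (intro member_le_sum) auto

lemma sqnorm_split: "sqnorm u k = (u k 0)\<^sup>2 + (\<Sum>j=1..n. (u k j)\<^sup>2)"
  unfolding sqnorm_def by (simp add: atMost_atLeast0 sum.atLeast_Suc_atMost)

lemma total_square_le: "(total u k)\<^sup>2 \<le> real n * sqnorm u k"
proof -
  have "(total u k)\<^sup>2 \<le> (\<Sum>j=1..n. (u k j)\<^sup>2) * real n"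
    using sum_squared_le_sum_of_squares[of "u k" "{1..n}"] by (simp add: total_def)
  also have "\<dots> \<le> sqnorm u k * real n"
    by (intro mult_right_mono) (auto simp: sqnorm_split)
  finally show ?thesis by (simp add: mult.commute)
qed

lemma functional_upper:
  obtains C where "0 < C" "\<And>u. functional u \<le> C * hist_sqnorm u"
proof -
  \<comment> \<open>The three summands count the terms of the leader, of the totals and of the
    second delay line in \<open>storage\<close>.\<close>
  define L where "L = p + (real T\<^sub>1 + 1) * real n
    + real T\<^sub>0 * ((2 * \<beta>\<^sup>2 + 2 * e\<^sup>2 * real n) + \<kappa> * (p + real n))"
  have "functional u \<le> (weight * L + 1) * hist_sqnorm u" for u
  proof -
    let ?H = "hist_sqnorm u"
    have sq: "(u k 0)\<^sup>2 \<le> ?H" if "k \<le> T\<^sub>0 + T\<^sub>1" for k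
      using square_le_sqnorm[of 0 u k] sqnorm_le_hist_sqnorm[OF that, of u] by simp
    have tot: "(total u k)\<^sup>2 \<le> real n * ?H" if "k \<le> T\<^sub>0 + T\<^sub>1" for k
      using total_square_le[of u k] mult_left_mono[OF sqnorm_le_hist_sqnorm[OF that, of u], of "real n"]
      by simp
    have resp: "(response u k)\<^sup>2 \<le> (2 * \<beta>\<^sup>2 + 2 * e\<^sup>2 * real n) * ?H" if "k \<le> T\<^sub>0" for k
    proof -
      have "(response u k)\<^sup>2 \<le> 2 * \<beta>\<^sup>2 * (u k 0)\<^sup>2 + 2 * e\<^sup>2 * (total u (k + T\<^sub>1))\<^sup>2"
        using zero_le_power2[of "\<beta> * u k 0 - e * total u (k + T\<^sub>1)"]
        by (simp add: response_def power2_eq_square algebra_simps)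
      also have "\<dots> \<le> 2 * \<beta>\<^sup>2 * ?H + 2 * e\<^sup>2 * (real n * ?H)"
        using that by (intro add_mono mult_left_mono sq tot) auto
      finally show ?thesis by (simp add: algebra_simps)
    qed
    have supp: "supply_rate u k \<le> (p + real n) * ?H" if "k \<le> T\<^sub>0" for k
    proof -
      have "p * (u k 0)\<^sup>2 \<le> p * ?H"
        using p sq[of k] that by simp
      then show ?thesis
        using tot[of "k + T\<^sub>1"] that unfolding supply_rate_def distrib_right by linarith
    qed
    have "(\<Sum>k\<le>T\<^sub>1. (total u k)\<^sup>2) \<le> (\<Sum>k\<le>T\<^sub>1. real n * ?H)"
      by (intro sum_mono tot) auto
    moreover have "(\<Sum>k<T\<^sub>0. (response u (Suc k))\<^sup>2 + \<kappa> * supply_rate u (Suc k))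
        \<le> (\<Sum>k<T\<^sub>0. (2 * \<beta>\<^sup>2 + 2 * e\<^sup>2 * real n) * ?H + \<kappa> * ((p + real n) * ?H))"
      using \<kappa> by (intro sum_mono add_mono mult_left_mono resp supp) auto
    moreover have "p * (u 0 0)\<^sup>2 \<le> p * ?H"
      using p sq[of 0] by simp
    ultimately have "storage u \<le> L * ?H"
      unfolding storage_def L_def by (simp add: algebra_simps)
    then have "weight * storage u \<le> weight * (L * ?H)"
      using weight_pos by simp
    moreover have "fading_norm u \<le> ?H"
      unfolding fading_norm_def hist_sqnorm_def
    proof (intro sum_mono)
      fix k
      have "0 \<le> real k * rate * sqnorm u k"
        using rate_pos sqnorm_nonneg by simp
      then show "(1 - real k * rate) * sqnorm u k \<le> sqnorm u k"
        by (simp add: algebra_simps)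
    qed
    ultimately show ?thesis
      by (simp add: functional_def algebra_simps)
  qed
  moreover have "0 < weight * L + 1"
    using weight_pos p \<kappa> unfolding L_def
    by (intro add_nonneg_pos mult_nonneg_nonneg add_nonneg_nonneg) auto
  ultimately show thesis using that by blast
qed

text \<open>\<open>u'\<close> is the history one step later. Old entries only shift, so the energy
  changes only through new entries and through those that reach the end of a delay line. The storage
  loss pays for the new entries up to half the squares of the oldest ones, and that half is released
  by \<open>fading_norm\<close>.\<close>

lemma functional_decrease:
  assumes shift: "\<And>k i. k < T\<^sub>0 + T\<^sub>1 \<Longrightarrow> i \<le> n \<Longrightarrow> u' (Suc k) i = u k i"
    and followers: "\<And>j. j \<in> {1..n} \<Longrightarrow>
      u' 0 j = - \<delta> / 2 * u T\<^sub>0 0 - \<delta> / 2 * (total u (T\<^sub>0 + T\<^sub>1) - u (T\<^sub>0 + T\<^sub>1) j)"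
    and leader: "p * (u' 0 0)\<^sup>2 + (response u 0)\<^sup>2 \<le> (1 - 2 * \<kappa>) * supply_rate u 0"
  shows "functional u' \<le> functional u - rate * hist_sqnorm u"
proof -
  have total_shift: "total u' (Suc k) = total u k" if "k < T\<^sub>0 + T\<^sub>1" for k
    unfolding total_def using that shift by (intro sum.cong) auto
  have sqnorm_shift: "sqnorm u' (Suc k) = sqnorm u k" if "k < T\<^sub>0 + T\<^sub>1" for k
    unfolding sqnorm_def using that shift by (intro sum.cong) auto
  have response_shift: "response u' (Suc k) = response u k"
    and supply_shift: "supply_rate u' (Suc k) = supply_rate u k" if "k < T\<^sub>0" for k
    using that shift[of k 0] total_shift[of "k + T\<^sub>1"] by (auto simp: response_def supply_rate_def)
  \<comment> \<open>Each follower omits its own entry, so summing leaves \<open>n - 1\<close> copies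
    of the total, which is the origin of \<open>e\<close>.\<close>
  have total_0: "total u' 0 = - response u T\<^sub>0"
  proof -
    have "total u' 0 = (\<Sum>j=1..n. - \<delta> / 2 * u T\<^sub>0 0 - \<delta> / 2 * total u (T\<^sub>0 + T\<^sub>1)
        + \<delta> / 2 * u (T\<^sub>0 + T\<^sub>1) j)"
      unfolding total_def[of u' 0] using followers by (intro sum.cong) (auto simp: algebra_simps)
    also have "\<dots> = real n * (- \<delta> / 2 * u T\<^sub>0 0 - \<delta> / 2 * total u (T\<^sub>0 + T\<^sub>1))
        + \<delta> / 2 * total u (T\<^sub>0 + T\<^sub>1)"
      by (simp add: sum.distrib total_def sum_distrib_left)
    also have "\<dots> = - response u T\<^sub>0"
      unfolding response_def by (simp add: \<beta> e field_simps)
    finally show ?thesis .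
  qed
  have telescope: "(\<Sum>k<T. f k) + f T = f 0 + (\<Sum>k<T. f (Suc k))" for f :: "nat \<Rightarrow> real" and T
    using sum.lessThan_Suc_shift[of f T] by simp

  \<comment> \<open>The response leaving the line of length \<open>T\<^sub>0\<close> re-enters as
    the new total; the total dropped at lag \<open>T\<^sub>1\<close> is part of
    \<open>supply_rate u 0\<close>.\<close>
  have "(\<Sum>k\<le>T\<^sub>1. (total u' k)\<^sup>2) = (response u T\<^sub>0)\<^sup>2 + (\<Sum>k<T\<^sub>1. (total u k)\<^sup>2)"
    unfolding lessThan_Suc_atMost[symmetric] sum.lessThan_Suc_shift
    by (auto simp: total_0 total_shift intro!: sum.cong)
  moreover have "(\<Sum>k\<le>T\<^sub>1. (total u k)\<^sup>2) = (\<Sum>k<T\<^sub>1. (total u k)\<^sup>2) + (total u T\<^sub>1)\<^sup>2"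
    by (simp flip: lessThan_Suc_atMost)
  moreover define f where "f k = (response u k)\<^sup>2 + \<kappa> * supply_rate u k" for k
  have "(\<Sum>k<T\<^sub>0. (response u' (Suc k))\<^sup>2 + \<kappa> * supply_rate u' (Suc k)) = (\<Sum>k<T\<^sub>0. f k)"
    by (intro sum.cong) (auto simp: response_shift supply_shift f_def)
  ultimately have "storage u' = p * (u' 0 0)\<^sup>2 + (response u T\<^sub>0)\<^sup>2 + (\<Sum>k<T\<^sub>1. (total u k)\<^sup>2)
      + (\<Sum>k<T\<^sub>0. f k)"
    and "storage u = p * (u 0 0)\<^sup>2 + (\<Sum>k<T\<^sub>1. (total u k)\<^sup>2) + (total u T\<^sub>1)\<^sup>2 + (\<Sum>k<T\<^sub>0. f (Suc k))"
    unfolding storage_def by (simp_all add: f_def)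
  \<comment> \<open>Of the margin \<open>2 * \<kappa>\<close>, one half loads the copy of the supply
    entering at lag \<open>0\<close> and the other half is lost there. The copy leaving at lag
    \<open>T\<^sub>0\<close> is lost as well.\<close>
  then have storage_step: "storage u' \<le> storage u - \<kappa> * supply_rate u 0 - \<kappa> * supply_rate u T\<^sub>0"
    using leader telescope[of f T\<^sub>0] unfolding f_def by (simp add: supply_rate_def algebra_simps)

  have weight_\<kappa>: "weight * \<kappa> = (real n + 1) * (1 / p + 1)"
    using \<kappa> by (simp add: weight_def)
  have leader_bound: "(u' 0 0)\<^sup>2 \<le> 1 / p * supply_rate u 0"
  proof -
    have "(1 - 2 * \<kappa>) * supply_rate u 0 \<le> 1 * supply_rate u 0"
      using \<kappa> supply_nonneg by (intro mult_right_mono) auto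
    then have "p * (u' 0 0)\<^sup>2 \<le> supply_rate u 0"
      using leader zero_le_power2[of "response u 0"] by linarith
    then show ?thesis using p by (simp add: field_simps)
  qed
  \<comment> \<open>The factor \<open>1 / 2\<close> equals the weight
    \<open>1 - (T + 1) * rate\<close> one lag beyond the last, so the oldest entry cancels when it
    drops out of \<open>fading_norm\<close>.\<close>
  have follower_bound:
    "(u' 0 j)\<^sup>2 \<le> 1 / 2 * (u (T\<^sub>0 + T\<^sub>1) j)\<^sup>2 + (1 / p + 1) * supply_rate u T\<^sub>0" if j: "j \<in> {1..n}" for j
  proof -
    define v s w where "v = u T\<^sub>0 0" and "s = total u (T\<^sub>0 + T\<^sub>1)" and "w = u (T\<^sub>0 + T\<^sub>1) j"
    have "(u' 0 j)\<^sup>2 = (\<delta> / 2)\<^sup>2 * (w - (v + s))\<^sup>2"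
      unfolding followers[OF j] v_def s_def w_def power_mult_distrib[symmetric]
      by (simp add: algebra_simps)
    also have "\<dots> \<le> (1 / 2)\<^sup>2 * (w - (v + s))\<^sup>2"
      using \<delta> by (intro mult_right_mono power_mono) auto
    also have "\<dots> \<le> 1 / 2 * w\<^sup>2 + (v\<^sup>2 + s\<^sup>2)"
      using zero_le_power2[of "w + (v + s)"] zero_le_power2[of "v - s"]
      by (simp add: power2_eq_square algebra_simps)
    also have "v\<^sup>2 + s\<^sup>2 \<le> (1 / p + 1) * supply_rate u T\<^sub>0"
      using p by (simp add: supply_rate_def v_def s_def field_simps)
    finally show ?thesis by (simp add: w_def)
  qed
  have "sqnorm u' 0 \<le> 1 / p * supply_rate u 0
      + (\<Sum>j=1..n. 1 / 2 * (u (T\<^sub>0 + T\<^sub>1) j)\<^sup>2 + (1 / p + 1) * supply_rate u T\<^sub>0)"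
    unfolding sqnorm_split using leader_bound follower_bound by (intro add_mono sum_mono) auto
  also have "\<dots> = 1 / p * supply_rate u 0 + 1 / 2 * (\<Sum>j=1..n. (u (T\<^sub>0 + T\<^sub>1) j)\<^sup>2)
      + real n * (1 / p + 1) * supply_rate u T\<^sub>0"
    by (simp add: sum.distrib sum_distrib_left)
  also have "\<dots> \<le> weight * \<kappa> * supply_rate u 0 + 1 / 2 * sqnorm u (T\<^sub>0 + T\<^sub>1) + weight * \<kappa> * supply_rate u T\<^sub>0"
    unfolding weight_\<kappa>
    using p by (intro add_mono mult_right_mono supply_nonneg mult_left_mono)
      (auto simp: sqnorm_split algebra_simps)
  finally have current: "sqnorm u' 0
      \<le> weight * \<kappa> * supply_rate u 0 + 1 / 2 * sqnorm u (T\<^sub>0 + T\<^sub>1) + weight * \<kappa> * supply_rate u T\<^sub>0" .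

  define T where "T = T\<^sub>0 + T\<^sub>1"
  have "fading_norm u' = sqnorm u' 0 + (\<Sum>k<T. (1 - real (Suc k) * rate) * sqnorm u k)"
    unfolding fading_norm_def T_def[symmetric] lessThan_Suc_atMost[symmetric] sum.lessThan_Suc_shift
    using sqnorm_shift by (auto simp: T_def intro!: sum.cong)
  also have "(\<Sum>k<T. (1 - real (Suc k) * rate) * sqnorm u k)
      = (\<Sum>k<T. (1 - real k * rate) * sqnorm u k) - rate * (\<Sum>k<T. sqnorm u k)"
    unfolding sum_distrib_left sum_subtractf[symmetric] by (intro sum.cong) (auto simp: algebra_simps)
  also have "(\<Sum>k<T. (1 - real k * rate) * sqnorm u k) = fading_norm u - (1 - real T * rate) * sqnorm u T"
    by (simp add: fading_norm_def T_def flip: lessThan_Suc_atMost)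
  also have "(\<Sum>k<T. sqnorm u k) = hist_sqnorm u - sqnorm u T"
    by (simp add: hist_sqnorm_def T_def flip: lessThan_Suc_atMost)
  finally have "fading_norm u' = sqnorm u' 0 + fading_norm u - rate * hist_sqnorm u
      - (1 - (real T + 1) * rate) * sqnorm u T"
    by (simp add: algebra_simps)
  then have "fading_norm u' = sqnorm u' 0 + fading_norm u - rate * hist_sqnorm u - 1 / 2 * sqnorm u T"
    unfolding T_def rate_total by simp
  moreover have "weight * storage u' \<le> weight * (storage u - \<kappa> * supply_rate u 0 - \<kappa> * supply_rate u T\<^sub>0)"
    using storage_step weight_pos by (intro mult_left_mono) auto
  ultimately show ?thesis
    using current unfolding functional_def T_def by (simp add: algebra_simps)
qed

end

section \<open>Stability of the positive equilibrium\<close>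

theorem theorem4:
  fixes n \<tau>\<^sub>0 \<tau>\<^sub>1 \<tau>\<^sub>2 :: nat
    and \<alpha> b \<delta> a\<^sub>0 a\<^sub>1 q\<^sub>0 q\<^sub>1 \<epsilon>\<^sub>0 \<epsilon>\<^sub>1 \<epsilon>\<^sub>2 :: real
  assumes "n \<ge> 1"
    and "\<alpha> > 0" and "b > 0"
    and "0 < \<delta>" and "\<delta> < 1"
    and "0 < a\<^sub>0" and "a\<^sub>0 \<le> a\<^sub>1"
    and "\<tau>\<^sub>0 + \<tau>\<^sub>1 = \<tau>\<^sub>2"
    and "(2 + (real n - 1) * \<delta>) * a\<^sub>0 > real n * \<delta> * a\<^sub>1"
    and "a\<^sub>1 > \<delta> * a\<^sub>0"
    and "q\<^sub>0 = ((2 + (real n - 1) * \<delta>) * a\<^sub>0 - real n * \<delta> * a\<^sub>1)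
              / (b * (2 + (real n - 1) * \<delta> - real n * \<delta>\<^sup>2))"
    and "q\<^sub>1 = (a\<^sub>1 - \<delta> * a\<^sub>0) / (b * (2 + (real n - 1) * \<delta> - real n * \<delta>\<^sup>2))"
    and "\<epsilon>\<^sub>0 = real n * \<delta>\<^sup>2 / 2"
    and "\<epsilon>\<^sub>1 = \<alpha> * (((2 + (real n - 1) * \<delta>) * a\<^sub>0 - real n * \<delta> * a\<^sub>1)
                   / (2 + (real n - 1) * \<delta> - real n * \<delta>\<^sup>2)) - 1"
    and "\<epsilon>\<^sub>2 = (real n - 1) * \<delta> / 2"
    and "\<epsilon>\<^sub>2 < 1"
    and "\<epsilon>\<^sub>1 < (1 - \<epsilon>\<^sub>2 - \<epsilon>\<^sub>0) / (1 - \<epsilon>\<^sub>2 + \<epsilon>\<^sub>0)"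
  shows "asymptotically_stable_equilibrium n \<alpha> b \<delta> a\<^sub>0 a\<^sub>1 \<tau>\<^sub>0 \<tau>\<^sub>1 \<tau>\<^sub>2
           (\<lambda>i. if i = 0 then q\<^sub>0 else q\<^sub>1)"

proof -
  define \<tau> where "\<tau> = \<tau>\<^sub>0 + \<tau>\<^sub>1"
  define D where "D = 2 + (real n - 1) * \<delta> - real n * \<delta>\<^sup>2"
  define E where "E = (\<lambda>i :: nat. if i = 0 then q\<^sub>0 else q\<^sub>1 :: real)"
  define F where "F = history_map n \<alpha> b \<delta> a\<^sub>0 a\<^sub>1 \<tau>\<^sub>0 \<tau>\<^sub>1 \<tau>\<^sub>2"
  define P where "P = constant_history n \<tau> E"
  define dev where "dev x k i = x (k, i) - E i" for x :: "nat \<times> nat \<Rightarrow> real" and k i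
  have max_delay: "max_delay \<tau>\<^sub>0 \<tau>\<^sub>1 \<tau>\<^sub>2 = \<tau>"
    by (simp add: max_delay_def \<tau>_def flip: assms(8))

  \<comment> \<open>\<open>D\<close> is \<open>2 - \<delta>\<close> plus this quantity.\<close>
  have "0 \<le> real n * \<delta> * (1 - \<delta>)"
    using assms(4,5) by simp
  then have D: "0 < D"
    using assms(5) by (simp add: D_def power2_eq_square algebra_simps)
  have bq0: "b * q\<^sub>0 * D = (2 + (real n - 1) * \<delta>) * a\<^sub>0 - real n * \<delta> * a\<^sub>1"
    and bq1: "b * q\<^sub>1 * D = a\<^sub>1 - \<delta> * a\<^sub>0"
    using assms(3) D unfolding assms(11,12) D_def[symmetric] by simp_all
  \<comment> \<open>The equilibrium equations are solved for \<open>a\<^sub>0\<close> and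
    \<open>a\<^sub>1\<close>; substituting them below cancels all constant terms of the recurrences
    in deviations.\<close>
  have "a\<^sub>0 * D = (b * q\<^sub>0 + b * \<delta> * real n * q\<^sub>1) * D"
    using bq0 bq1 by (simp add: D_def power2_eq_square) algebra
  then have a0: "a\<^sub>0 = b * q\<^sub>0 + b * \<delta> * real n * q\<^sub>1"
    using D by simp
  have "a\<^sub>1 * D = (b * (2 * q\<^sub>1 + \<delta> * q\<^sub>0 + \<delta> * (real n - 1) * q\<^sub>1)) * D"
    using bq0 bq1 by (simp add: D_def power2_eq_square) algebra
  then have a1: "a\<^sub>1 = b * (2 * q\<^sub>1 + \<delta> * q\<^sub>0 + \<delta> * (real n - 1) * q\<^sub>1)"
    using D by simp
  have "0 < q\<^sub>0"
    using assms(3,9) D unfolding assms(11) D_def[symmetric] by simp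
  have \<epsilon>1: "\<epsilon>\<^sub>1 = \<alpha> * b * q\<^sub>0 - 1"
    using assms(3) D unfolding assms(14,11) D_def[symmetric] by simp
  then have \<epsilon>1_gt: "- 1 < \<epsilon>\<^sub>1"
    using assms(2,3) \<open>0 < q\<^sub>0\<close> by simp
  have \<epsilon>0: "0 < \<epsilon>\<^sub>0"
    using assms(1,4) by (simp add: assms(13))
  have "\<epsilon>\<^sub>1 * (1 - \<epsilon>\<^sub>2 + \<epsilon>\<^sub>0) < 1 - \<epsilon>\<^sub>2 - \<epsilon>\<^sub>0"
    using assms(16,17) \<epsilon>0 by (simp add: pos_less_divide_eq)
  then have gain1: "(1 + \<epsilon>\<^sub>1) * \<epsilon>\<^sub>0 < (1 - \<epsilon>\<^sub>1) * (1 - \<epsilon>\<^sub>2)"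
    by (simp add: algebra_simps)
  \<comment> \<open>\<open>D\<close> is twice
    \<open>1 + \<epsilon>\<^sub>2 - \<epsilon>\<^sub>0\<close>.\<close>
  have "\<epsilon>\<^sub>0 < 1 + \<epsilon>\<^sub>2"
    using D by (simp add: D_def assms(13,15) field_simps)
  then have gain2: "(1 + \<epsilon>\<^sub>1) * \<epsilon>\<^sub>0 < (1 + \<epsilon>\<^sub>1) * (1 + \<epsilon>\<^sub>2)"
    using \<epsilon>1_gt by simp
  have "0 < (1 + \<epsilon>\<^sub>1) * \<epsilon>\<^sub>0"
    using \<epsilon>1_gt \<epsilon>0 by simp
  with gain1 have "0 < (1 - \<epsilon>\<^sub>1) * (1 - \<epsilon>\<^sub>2)"
    by linarith
  then have \<epsilon>1_lt: "\<epsilon>\<^sub>1 < 1"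
    using assms(16) by (simp add: zero_less_mult_iff)

  define \<beta> where "\<beta> = real n * \<delta> / 2"
  \<comment> \<open>Chosen to make \<open>p * (1 + \<epsilon>\<^sub>1) * \<delta>\<close> equal to
    \<open>\<beta>\<close>, which is the symmetry of the scaled map.\<close>
  define p where "p = real n / (2 * (1 + \<epsilon>\<^sub>1))"
  have p: "0 < p"
    using assms(1) \<epsilon>1_gt by (simp add: p_def)
  have p': "p * (1 + \<epsilon>\<^sub>1) = real n / 2"
    using \<epsilon>1_gt by (simp add: p_def field_simps)
  have \<beta>: "\<beta> = p * (1 + \<epsilon>\<^sub>1) * \<delta>"
    unfolding p' \<beta>_def by simp
  have m: "(1 + \<epsilon>\<^sub>1) * \<epsilon>\<^sub>0 = p * (1 + \<epsilon>\<^sub>1)\<^sup>2 * \<delta>\<^sup>2"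
    unfolding power2_eq_square[of "1 + _"] mult.assoc[symmetric] p' assms(13) by simp
  obtain \<kappa> r where \<kappa>: "0 < \<kappa>" and r: "0 < r" and contraction: "\<And>a' u s. \<bar>a' - \<epsilon>\<^sub>1\<bar> < r \<Longrightarrow>
      p * (a' * u + (1 + a') * \<delta> * s)\<^sup>2 + (\<beta> * u + \<epsilon>\<^sub>2 * s)\<^sup>2 \<le> (1 - 2 * \<kappa>) * (p * u\<^sup>2 + s\<^sup>2)"
    using robust_contraction[OF _ p \<beta> m gain1 gain2] \<epsilon>1_gt \<epsilon>1_lt by (auto simp: abs_less_iff)
  interpret oligopoly_functional n \<tau>\<^sub>0 \<tau>\<^sub>1 \<delta> \<beta> \<epsilon>\<^sub>2 p \<kappa>
    using p \<kappa> assms(4,5,15) by unfold_locales (auto simp: \<beta>_def)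
  obtain C where C: "0 < C" "\<And>u. functional u \<le> C * hist_sqnorm u"
    using functional_upper by blast

  have dist_sq: "(history_dist n \<tau> x P)\<^sup>2 = hist_sqnorm (dev x)" for x
  proof -
    have "(history_dist n \<tau> x P)\<^sup>2 = (\<Sum>q\<in>{0..\<tau>} \<times> {0..n}. (x q - P q)\<^sup>2)"
      by (simp add: history_dist_def L2_set_def history_index_def sum_nonneg)
    also have "\<dots> = (\<Sum>k\<le>\<tau>. \<Sum>i\<le>n. (dev x k i)\<^sup>2)"
      unfolding sum.cartesian_product atMost_atLeast0
      by (intro sum.cong) (auto simp: dev_def P_def constant_history_def history_index_def)
    finally show ?thesis
      by (simp add: hist_sqnorm_def sqnorm_def \<tau>_def)
  qed
  have F_Suc: "F x (Suc k, i) = x (k, i)" if "k < \<tau>" "i \<le> n" for x k i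
    using that by (simp add: F_def history_map_def max_delay history_index_def)
  have F_0: "F x (0, i) = next_quantity n \<alpha> b \<delta> a\<^sub>0 a\<^sub>1 \<tau>\<^sub>0 \<tau>\<^sub>1 \<tau>\<^sub>2 x i" if "i \<le> n" for x i
    using that by (simp add: F_def history_map_def max_delay history_index_def)
  have sum_dev: "(\<Sum>j=1..n. x (k, j)) = real n * q\<^sub>1 + total (dev x) k" for x k
    by (simp add: total_def dev_def E_def sum_subtractf)
  have leader: "dev (F x) 0 0
      = - ((\<alpha> * b * x (0, 0) - 1) * dev x 0 0 + \<alpha> * b * x (0, 0) * \<delta> * total (dev x) \<tau>\<^sub>1)" for x
  proof -
    have x0: "x (0, 0) = q\<^sub>0 + dev x 0 0"
      by (simp add: dev_def E_def)
    have "dev (F x) 0 0 = next_quantity n \<alpha> b \<delta> a\<^sub>0 a\<^sub>1 \<tau>\<^sub>0 \<tau>\<^sub>1 \<tau>\<^sub>2 x 0 - q\<^sub>0"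
      by (simp add: dev_def E_def F_0)
    then show ?thesis
      unfolding next_quantity_def sum_dev a0 by (simp add: x0 algebra_simps)
  qed
  have follower: "dev (F x) 0 j
      = - \<delta> / 2 * dev x \<tau>\<^sub>0 0 - \<delta> / 2 * (total (dev x) (\<tau>\<^sub>0 + \<tau>\<^sub>1) - dev x (\<tau>\<^sub>0 + \<tau>\<^sub>1) j)"
    if j: "j \<in> {1..n}" for x j
  proof -
    have rivals: "(\<Sum>i\<in>{1..n} - {j}. x (\<tau>\<^sub>0 + \<tau>\<^sub>1, i))
        = real n * q\<^sub>1 + total (dev x) (\<tau>\<^sub>0 + \<tau>\<^sub>1) - (q\<^sub>1 + dev x (\<tau>\<^sub>0 + \<tau>\<^sub>1) j)"
      using j sum_dev[of x "\<tau>\<^sub>0 + \<tau>\<^sub>1"] by (simp add: sum_diff1 dev_def E_def)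
    have x0: "x (\<tau>\<^sub>0, 0) = q\<^sub>0 + dev x \<tau>\<^sub>0 0"
      by (simp add: dev_def E_def)
    have "dev (F x) 0 j = next_quantity n \<alpha> b \<delta> a\<^sub>0 a\<^sub>1 \<tau>\<^sub>0 \<tau>\<^sub>1 \<tau>\<^sub>2 x j - q\<^sub>1"
      using j by (simp add: dev_def E_def F_0)
    also have "\<dots> = a\<^sub>1 / (2 * b) - \<delta> / 2 * (q\<^sub>0 + dev x \<tau>\<^sub>0 0)
        - \<delta> / 2 * (real n * q\<^sub>1 + total (dev x) (\<tau>\<^sub>0 + \<tau>\<^sub>1) - (q\<^sub>1 + dev x (\<tau>\<^sub>0 + \<tau>\<^sub>1) j)) - q\<^sub>1"
      using j unfolding next_quantity_def assms(8)[symmetric] rivals x0 by simp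
    also have "a\<^sub>1 / (2 * b) = (2 * q\<^sub>1 + \<delta> * q\<^sub>0 + \<delta> * (real n - 1) * q\<^sub>1) / 2"
      using assms(3) unfolding a1 by simp
    finally show ?thesis
      by (simp add: field_simps)
  qed

  \<comment> \<open>On the index set \<open>P\<close> has zero deviations, which
    \<open>leader\<close> and \<open>follower\<close> preserve; off it both sides are
    \<open>undefined\<close>.\<close>
  have F_P: "F P = P"
  proof
    fix z :: "nat \<times> nat"
    obtain k i where z: "z = (k, i)" by (cases z)
    have dev_P: "dev P k i = 0" if "k \<le> \<tau>" "i \<le> n" for k i
      using that by (simp add: dev_def P_def constant_history_def history_index_def)
    then have "total (dev P) k = 0" if "k \<le> \<tau>" for k
      using that unfolding total_def by (intro sum.neutral) auto
    then have "dev (F P) 0 i = 0" if "i \<le> n" for i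
      using that dev_P leader[of P] follower[of i P] by (cases "i = 0") (auto simp: \<tau>_def)
    then have "dev (F P) k i = dev P k i" if "k \<le> \<tau>" "i \<le> n"
      using that dev_P by (cases k) (auto simp: dev_def F_Suc)
    then show "F P z = P z"
      by (cases "k \<le> \<tau> \<and> i \<le> n")
        (auto simp: z dev_def F_def history_map_def max_delay P_def constant_history_def history_index_def)
  qed

  have "asymptotically_stable_fixpoint (history_space n \<tau>) (history_dist n \<tau>) F P"
  \<comment> \<open>The multiplier \<open>\<alpha> * b * x (0, 0) - 1\<close> differs from
    \<open>\<epsilon>\<^sub>1\<close> by \<open>\<alpha> * b\<close> times the leader's deviation,
    so the radius \<open>r / (\<alpha> * b)\<close> keeps it where \<open>contraction\<close>
    applies.\<close>
  proof (rule quadratic_lyapunov_asymptotically_stable[where V = "\<lambda>x. functional (dev x)"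
        and c = "1 / 2" and C = C and \<eta> = rate and r = "r / (\<alpha> * b)"])
    show "P \<in> history_space n \<tau>"
      by (simp add: P_def constant_history_def history_space_def)
    show "F \<in> history_space n \<tau> \<rightarrow> history_space n \<tau>"
      using history_map_in_space[of n \<alpha> b \<delta> a\<^sub>0 a\<^sub>1 \<tau>\<^sub>0 \<tau>\<^sub>1 \<tau>\<^sub>2] unfolding F_def max_delay by auto
    show "0 \<le> history_dist n \<tau> x P" for x
      by (simp add: history_dist_def)
    show "functional (dev (F x)) \<le> functional (dev x) - rate * (history_dist n \<tau> x P)\<^sup>2"
      if x: "history_dist n \<tau> x P < r / (\<alpha> * b)" for x
      unfolding dist_sq
    proof (rule functional_decrease)
      have "(dev x 0 0)\<^sup>2 \<le> (history_dist n \<tau> x P)\<^sup>2"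
        unfolding dist_sq
        using square_le_sqnorm[of 0 "dev x" 0] sqnorm_le_hist_sqnorm[of 0 "dev x"] by simp
      then have "\<bar>dev x 0 0\<bar> \<le> history_dist n \<tau> x P"
        by (simp add: history_dist_def flip: abs_le_square_iff)
      with x have "\<bar>dev x 0 0\<bar> < r / (\<alpha> * b)"
        by linarith
      then have "\<alpha> * b * \<bar>dev x 0 0\<bar> < r"
        using assms(2,3) by (simp add: field_simps)
      moreover have "\<alpha> * b * x (0, 0) - 1 - \<epsilon>\<^sub>1 = \<alpha> * b * dev x 0 0"
        by (simp add: \<epsilon>1 dev_def E_def algebra_simps)
      ultimately have "\<bar>\<alpha> * b * x (0, 0) - 1 - \<epsilon>\<^sub>1\<bar> < r"
        using assms(2,3) by (simp add: abs_mult)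
      from contraction[OF this, of "dev x 0 0" "total (dev x) \<tau>\<^sub>1"]
      show "p * (dev (F x) 0 0)\<^sup>2 + (response (dev x) 0)\<^sup>2 \<le> (1 - 2 * \<kappa>) * supply_rate (dev x) 0"
        unfolding leader power2_minus by (simp add: response_def supply_rate_def)
    next
      show "dev (F x) (Suc k) i = dev x k i" if "k < \<tau>\<^sub>0 + \<tau>\<^sub>1" "i \<le> n" for k i
        using that by (simp add: dev_def F_Suc \<tau>_def)
    qed (rule follower)
  qed (use assms(2,3) r C F_P rate_pos functional_lower in \<open>auto simp: dist_sq\<close>)
  then show ?thesis
    unfolding asymptotically_stable_equilibrium_def Let_def max_delay F_def P_def E_def .
qed

end
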